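(* Let $G=([n],E)$ be a directed graph and $\mathcal{S}_G=\langle\mathrm{E}_{i,j}\mid (i,j)\in E\rangle\le\mathrm{M}(n,\mathbb{C})$. The maximum number of vertices in an induced subgraph of $G$ that is not strongly connected equals the largest dimension of a subspace $U\le\mathbb{C}^n$ such that $\mathcal{S}_G[U]$ is reducible.
   Context: Directed graph: $E\subseteq[n]\times[n]$. For $S\subseteq[n]$, $G[S]$ has vertex set $S$ and arcs $E\cap(S\times S)$; strongly connected means a directed path exists between every ordered pair of vertices. For $\mathcal{S}\le\mathrm{M}(n,\mathbb{C})$ and a $d$-dimensional $U\le\mathbb{C}^n$, let $T_U$ be a $d\times n$ matrix whose rows form an orthonormal basis of $U$, and $\mathcal{S}[U]=\{T_UBT_U^*\mid B\in\mathcal{S}\}\le\mathrm{M}(d,\mathbb{C})$. A matrix space $\mathcal{T}\le\mathrm{M}(d,\mathbb{C})$ is reducible if there is a subspace $0\ne V<\mathbb{C}^d$ (row vectors) with $vB\in V$ for all $v\in V$, $B\in\mathcal{T}$. $\mathrm{E}_{i,j}$ is the elementary matrix with $1$ at $(i,j)$. *)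

theory Defs
  imports "Graph_Theory.Pair_Digraph" "Graph_Theory.Digraph_Component"
    "Jordan_Normal_Form.Schur_Decomposition"
begin

text \<open>
  Vertices are numbered \<open>0, \<dots>, n - 1\<close> instead of \<open>1, \<dots>, n\<close>, to agree with the row and column
  indices of the matrix library.  Loops are allowed; parallel arcs are not.

  In \<open>Graph_Theory\<close> a strongly connected digraph is nonempty by definition.  Here strong
  connectivity only asks for a directed path between every ordered pair of vertices, so the
  graph without vertices is (vacuously) strongly connected.  For nonempty vertex sets the two
  notions coincide, hence the condition \<open>S \<noteq> {}\<close>.
\<close>

definition non_strong_orders :: "'v pair_pre_digraph \<Rightarrow> nat set" where
  "non_strong_orders G =
    {card S | S. S \<subseteq> pverts G \<and> S \<noteq> {} \<and>
                 \<not> strongly_connected (induce_subgraph (with_proj G) S)}"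

definition elem_mat :: "nat \<Rightarrow> nat \<Rightarrow> nat \<Rightarrow> complex mat" where
  "elem_mat n i j = mat n n (\<lambda>(k, l). if k = i \<and> l = j then 1 else 0)"

definition graph_mat_space :: "nat \<Rightarrow> nat pair_pre_digraph \<Rightarrow> complex mat set" where
  "graph_mat_space n G =
    module.span class_ring (module_mat TYPE(complex) n n)
      {elem_mat n i j | i j. (i, j) \<in> parcs G}"

abbreviation vec_subspace :: "nat \<Rightarrow> complex vec set \<Rightarrow> bool" where
  "vec_subspace n U \<equiv> VectorSpace.subspace class_ring U (module_vec TYPE(complex) n)"

definition subspace_dim :: "nat \<Rightarrow> complex vec set \<Rightarrow> nat" where
  "subspace_dim n U =
    vectorspace.dim class_ring ((module_vec TYPE(complex) n)\<lparr>carrier := U\<rparr>)"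

definition orthonormal_basis_mat :: "nat \<Rightarrow> complex vec set \<Rightarrow> complex mat \<Rightarrow> bool" where
  "orthonormal_basis_mat n U T \<longleftrightarrow>
    T \<in> carrier_mat (subspace_dim n U) n \<and>
    (\<forall>i < dim_row T. \<forall>j < dim_row T. row T i \<bullet>c row T j = (if i = j then 1 else 0)) \<and>
    vec_space.row_space n T = U"

text \<open>
  \<open>T\<^sub>U\<close> is an arbitrary but fixed choice; another choice changes \<open>\<S>[U]\<close> only by a unitary
  conjugation, which does not affect reducibility.
\<close>

definition basis_mat :: "nat \<Rightarrow> complex vec set \<Rightarrow> complex mat" where
  "basis_mat n U = (SOME T. orthonormal_basis_mat n U T)"

definition compression :: "nat \<Rightarrow> complex mat set \<Rightarrow> complex vec set \<Rightarrow> complex mat set" where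
  "compression n \<S> U = {basis_mat n U * B * mat_adjoint (basis_mat n U) | B. B \<in> \<S>}"

text \<open>Vectors are row vectors here: \<open>B\<^sup>T *\<^sub>v v\<close> is the product \<open>v B\<close>.\<close>

definition reducible_mats :: "nat \<Rightarrow> complex mat set \<Rightarrow> bool" where
  "reducible_mats d \<T> \<longleftrightarrow>
    (\<exists>V. vec_subspace d V \<and> V \<noteq> {0\<^sub>v d} \<and> V \<noteq> carrier_vec d \<and>
         (\<forall>v \<in> V. \<forall>B \<in> \<T>. B\<^sup>T *\<^sub>v v \<in> V))"

definition reducible_dims :: "nat \<Rightarrow> complex mat set \<Rightarrow> nat set" where
  "reducible_dims n \<S> =
    {subspace_dim n U | U. vec_subspace n U \<and>
                           reducible_mats (subspace_dim n U) (compression n \<S> U)}"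

text \<open>Both sets are finite, so \<^const>\<open>Max\<close> is their maximum as soon as they are nonempty.\<close>

lemma finite_non_strong_orders:
  assumes "finite (pverts G)"
  shows "finite (non_strong_orders G)"
proof (rule finite_subset)
  show "non_strong_orders G \<subseteq> {..card (pverts G)}"
    using assms by (auto simp: non_strong_orders_def intro: card_mono)
qed simp

lemma (in vectorspace) subspace_dim_le_dim:
  assumes W: "VectorSpace.subspace K W V" and fin: fin_dim
  shows "vectorspace.dim K (vs W) \<le> dim"
proof -
  have sub: "submodule K W V"
    using W by (simp add: VectorSpace.subspace_def)
  have WV: "W \<subseteq> carrier V"
    using sub by (simp add: submodule_def)
  interpret W: vectorspace K "vs W"
    using W by (rule subspace_is_vs)
  have li: "W.lin_dep A = lin_dep A" if "A \<subseteq> W" for A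
    using span_li_not_depend(2)[OF that sub] .
  have bnd: "finite A \<and> card A \<le> dim" if "A \<subseteq> W \<and> W.lin_indpt A" for A
    using that WV li[of A] li_le_dim[OF fin, of A] by auto
  have empty: "{} \<subseteq> W \<and> W.lin_indpt {}"
    by (auto simp: W.lin_dep_def)
  obtain A where "finite A" and A: "maximal A (\<lambda>A. A \<subseteq> W \<and> W.lin_indpt A)"
    using maximal_exists[of "\<lambda>A. A \<subseteq> W \<and> W.lin_indpt A" dim "{}", OF bnd empty] by auto
  have AW: "A \<subseteq> W \<and> W.lin_indpt A"
    using A by (simp add: maximal_def)
  have "W.gen_set A"
    using A by (intro W.max_li_is_gen) simp
  then have "W.dim \<le> card A"
    using \<open>finite A\<close> AW by (intro W.gen_ge_dim) auto
  with bnd[OF AW] show ?thesis by simp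
qed

lemma finite_reducible_dims: "finite (reducible_dims n \<S>)"
proof (rule finite_subset)
  interpret vec_space "TYPE(complex)" n .
  show "reducible_dims n \<S> \<subseteq> {..n}"
    using subspace_dim_le_dim fin_dim dim_is_n
    by (auto simp: reducible_dims_def subspace_dim_def)
qed simp

end

theory Submission
  imports Defs
begin

text \<open>
  If \<open>A\<close> is a proper nonempty subset of \<open>S\<close> that no arc of \<open>G[S]\<close> leaves, then the vectors
  supported on \<open>A\<close> form an invariant subspace of the compression to the vectors supported
  on \<open>S\<close>.

  Conversely, let \<open>V\<close> be an invariant subspace of the compression to \<open>U\<close>, and let \<open>A\<close> and \<open>B\<close>
  be the supports, in the coordinates of the ambient space, of \<open>V\<close> and of its orthogonal
  complement in \<open>U\<close>.  Invariance under the elementary matrices says exactly that there is no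
  arc from \<open>A\<close> to \<open>B\<close>.  The two supports may overlap, but by orthogonality they are not the
  same singleton, so there are distinct \<open>u \<in> A\<close> and \<open>u' \<in> B\<close>; in \<open>G[A \<union> B]\<close> no arc leaves
  \<open>{u} \<union> (A - B)\<close>, a set that misses \<open>u'\<close>.  Finally \<open>card (A \<union> B) \<ge> dim U\<close>, since \<open>U\<close> is
  supported on \<open>A \<union> B\<close>.
\<close>

section \<open>Adjoints and matrices with orthonormal rows\<close>

lemma mat_adjoint_dim [simp]:
  "dim_row (mat_adjoint A) = dim_col A" "dim_col (mat_adjoint A) = dim_row A"
  by (auto simp: mat_adjoint_def)

lemma mat_adjoint_carrier [simp]: "A \<in> carrier_mat m n \<Longrightarrow> mat_adjoint A \<in> carrier_mat n m"
  by auto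

lemma mat_adjoint_index [simp]:
  "i < dim_col A \<Longrightarrow> j < dim_row A \<Longrightarrow> mat_adjoint A $$ (i, j) = conjugate (A $$ (j, i))"
  by (simp add: mat_adjoint_def mat_of_rows_index)

lemma mat_adjoint_adjoint [simp]: "mat_adjoint (mat_adjoint A) = A"
  by (rule eq_matI) auto

lemma mat_adjoint_transpose:
  "mat_adjoint (A\<^sup>T) = (mat_adjoint A)\<^sup>T"
  by (rule eq_matI) auto

lemma cscalar_prod_mult_mat_vec:
  fixes A :: "complex mat"
  assumes A: "A \<in> carrier_mat m n" and x: "x \<in> carrier_vec n" and y: "y \<in> carrier_vec m"
  shows "(A *\<^sub>v x) \<bullet>c y = x \<bullet>c (mat_adjoint A *\<^sub>v y)"
proof -
  have "(A *\<^sub>v x) \<bullet>c y = (\<Sum>i<m. \<Sum>j<n. A $$ (i, j) * x $ j * cnj (y $ i))"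
    using assms by (auto simp: scalar_prod_def sum_distrib_right lessThan_atLeast0 intro!: sum.cong)
  also have "\<dots> = (\<Sum>j<n. \<Sum>i<m. A $$ (i, j) * x $ j * cnj (y $ i))"
    by (rule sum.swap)
  also have "\<dots> = x \<bullet>c (mat_adjoint A *\<^sub>v y)"
    using assms
    by (auto simp: scalar_prod_def sum_distrib_left lessThan_atLeast0 algebra_simps intro!: sum.cong)
  finally show ?thesis .
qed

text \<open>The orthonormality clause of \<open>orthonormal_basis_mat\<close>, detached from any
  subspace so that it also applies to matrices built by hand.\<close>

definition orthonormal_rows :: "complex mat \<Rightarrow> bool" where
  "orthonormal_rows T \<longleftrightarrow>
    (\<forall>i < dim_row T. \<forall>j < dim_row T. row T i \<bullet>c row T j = (if i = j then 1 else 0))"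

lemma orthonormal_rows_mult_adjoint:
  assumes "orthonormal_rows T" "T \<in> carrier_mat m n"
  shows "T * mat_adjoint T = 1\<^sub>m m"
proof (rule eq_matI)
  fix i j assume ij: "i < dim_row (1\<^sub>m m :: complex mat)" "j < dim_col (1\<^sub>m m :: complex mat)"
  have "col (mat_adjoint T) j = conjugate (row T j)"
    using assms ij by (intro eq_vecI) auto
  then show "(T * mat_adjoint T) $$ (i, j) = 1\<^sub>m m $$ (i, j)"
    using assms ij by (auto simp: orthonormal_rows_def)
qed (use assms in auto)

text \<open>Vectors act as rows, so \<open>T\<^sup>T *\<^sub>v x\<close> is x T, the ambient vector
  with coordinates x; multiplying by the adjoint returns to coordinates because T T^* is the
  identity.\<close>

lemma orthonormal_rows_coisometry:
  assumes T: "orthonormal_rows T" "T \<in> carrier_mat m n" and x: "x \<in> carrier_vec m"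
  shows "(mat_adjoint T)\<^sup>T *\<^sub>v (T\<^sup>T *\<^sub>v x) = x"
proof -
  have "(mat_adjoint T)\<^sup>T *\<^sub>v (T\<^sup>T *\<^sub>v x) = ((mat_adjoint T)\<^sup>T * T\<^sup>T) *\<^sub>v x"
    using T x by (intro assoc_mult_mat_vec[symmetric]) auto
  also have "(mat_adjoint T)\<^sup>T * T\<^sup>T = (T * mat_adjoint T)\<^sup>T"
    using T by (intro transpose_mult[symmetric]) auto
  finally show ?thesis
    using x by (simp add: orthonormal_rows_mult_adjoint[OF T])
qed

text \<open>Moving one factor \<open>T\<^sup>T\<close> across the inner product turns it into
  \<open>(mat_adjoint T)\<^sup>T\<close>, which cancels against the other factor by
  \<open>orthonormal_rows_coisometry\<close>.\<close>

lemma orthonormal_rows_isometry: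
  assumes T: "orthonormal_rows T" "T \<in> carrier_mat m n"
    and x: "x \<in> carrier_vec m" and y: "y \<in> carrier_vec m"
  shows "(T\<^sup>T *\<^sub>v x) \<bullet>c (T\<^sup>T *\<^sub>v y) = x \<bullet>c y"
  using cscalar_prod_mult_mat_vec[of "T\<^sup>T" n m x "T\<^sup>T *\<^sub>v y"] assms
  by (simp add: mat_adjoint_transpose orthonormal_rows_coisometry)

section \<open>Orthonormal bases of subspaces and orthogonal projection\<close>

lemma vec_subspace_iff:
  "vec_subspace n U \<longleftrightarrow> U \<subseteq> carrier_vec n \<and> 0\<^sub>v n \<in> U \<and>
    (\<forall>v\<in>U. \<forall>w\<in>U. v + w \<in> U) \<and> (\<forall>c. \<forall>v\<in>U. c \<cdot>\<^sub>v v \<in> U)"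
  using vec_vs[of n] vec_module[of n]
  by (auto simp: VectorSpace.subspace_def submodule_def module_vec_simps class_ring_simps)

text \<open>Orthonormal rows are linearly independent, hence a basis of their span.\<close>

lemma subspace_dim_row_space:
  assumes T: "orthonormal_rows T" "T \<in> carrier_mat m n"
  shows "subspace_dim n (vec_space.row_space n T) = m"
proof -
  interpret vec_space "TYPE(complex)" n .
  let ?R = "set (rows T)"
  have R: "?R \<subseteq> carrier_vec n"
    using T by (auto simp: rows_def)
  have nth: "rows T ! i \<bullet>c rows T ! j = (if i = j then 1 else 0)" if "i < m" "j < m" for i j
    using that T by (auto simp: orthonormal_rows_def)
  \<comment> \<open>The set of rows forgets repetitions, so its cardinality is m only if the rows
    are distinct; equal rows at different indices would have inner product both 0 and 1.\<close>
  have "distinct (rows T)"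
    unfolding distinct_conv_nth
    using nth T by (metis (no_types, lifting) length_rows carrier_matD(1) zero_neq_one)
  then have card: "card ?R = m"
    using T by (simp add: distinct_card)
  have orth: "v \<bullet>c w = (if v = w then 1 else 0)" if "v \<in> ?R" "w \<in> ?R" for v w
    using that nth \<open>distinct (rows T)\<close> T
    by (auto simp: in_set_conv_nth nth_eq_iff_index_eq)
  have li: "lin_indpt ?R"
  proof (rule finite_lin_indpt2)
    fix a assume "lincomb a ?R = 0\<^sub>v n"
    show "\<forall>v\<in>?R. a v = 0"
    proof
      fix w assume w: "w \<in> ?R"
      \<comment> \<open>Pairing the vanishing combination with w isolates the coefficient
        \<open>a w\<close>.\<close>
      have "0 = lincomb a ?R \<bullet>c w"
        using w R \<open>lincomb a ?R = 0\<^sub>v n\<close> by auto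
      also have "\<dots> = (\<Sum>v\<in>?R. (a v \<cdot>\<^sub>v v) \<bullet>c w)"
        unfolding lincomb_def using R w by (intro finsum_scalar_prod_sum) auto
      also have "\<dots> = (\<Sum>v\<in>?R. a v * (if v = w then 1 else 0))"
      proof (intro sum.cong refl)
        fix v assume v: "v \<in> ?R"
        have "(a v \<cdot>\<^sub>v v) \<bullet>c w = a v * (v \<bullet>c w)"
          using R v w by (intro smult_scalar_prod_distrib[of _ n]) auto
        then show "(a v \<cdot>\<^sub>v v) \<bullet>c w = a v * (if v = w then 1 else 0)"
          using orth[OF v w] by simp
      qed
      also have "\<dots> = a w"
        using w by (simp add: if_distrib cong: if_cong)
      finally show "a w = 0" by simp
    qed
  qed (use R in auto)
  have sub: "submodule class_ring (span ?R) V"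
    using R by (rule span_is_submodule)
  have inR: "?R \<subseteq> span ?R"
    using R by (rule in_own_span)
  interpret W: vectorspace class_ring "vs (span ?R)"
    using span_is_subspace[OF R] by (rule subspace_is_vs)
  have "W.basis ?R"
    unfolding W.basis_def using li inR span_li_not_depend[OF inR sub]
    by auto
  then have "W.dim = card ?R"
    by (intro W.dim_basis) auto
  then show ?thesis
    using card by (simp add: subspace_dim_def row_space_def)
qed

text \<open>Independent subsets of U have at most n elements, so a maximal one exists; a vector of U
  outside its span could still be adjoined. Span and independence refer to the ambient space, where
  Gram-Schmidt is applied.\<close>

lemma (in vec_space) subspace_basis_exists:
  assumes U: "VectorSpace.subspace class_ring U V"
  obtains A where "finite A" "A \<subseteq> U" "lin_indpt A" "span A = U"
proof -
  have sub: "submodule class_ring U V"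
    using U by (simp add: VectorSpace.subspace_def)
  have Uc: "U \<subseteq> carrier_vec n"
    using sub by (simp add: submodule_def module_vec_simps)
  have bnd: "finite A \<and> card A \<le> dim" if "A \<subseteq> U \<and> lin_indpt A" for A
    using that Uc li_le_dim[OF fin_dim, of A] by auto
  have empty: "{} \<subseteq> U \<and> lin_indpt {}"
    by (auto simp: lin_dep_def)
  obtain A where fin: "finite A" and A: "maximal A (\<lambda>A. A \<subseteq> U \<and> lin_indpt A)"
    using maximal_exists[of "\<lambda>A. A \<subseteq> U \<and> lin_indpt A" dim "{}", OF bnd empty] by auto
  have AU: "A \<subseteq> U" and li: "lin_indpt A"
    using A by (auto simp: maximal_def)
  have "U \<subseteq> span A"
  proof
    fix u assume u: "u \<in> U"
    show "u \<in> span A"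
    proof (rule ccontr)
      assume nu: "u \<notin> span A"
      have "u \<notin> A"
        using nu AU Uc in_own_span[of A] by auto
      then have "lin_indpt (A \<union> {u})"
        using lin_dep_iff_in_span[of A u] li nu AU Uc u by auto
      then have "A \<union> {u} = A"
        using A AU u unfolding maximal_def by blast
      then show False using \<open>u \<notin> A\<close> by auto
    qed
  qed
  moreover have "span A \<subseteq> U"
    by (rule span_is_subset[OF AU sub])
  ultimately show thesis
    using that fin AU li by blast
qed

lemma exists_normalizing_factor:
  fixes v :: "complex vec"
  assumes "v \<in> carrier_vec n" "v \<noteq> 0\<^sub>v n"
  obtains c where "c \<noteq> 0" "(c \<cdot>\<^sub>v v) \<bullet>c (c \<cdot>\<^sub>v v) = 1"
proof -
  define r where "r = Re (v \<bullet>c v)"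
  have "v \<bullet>c v > 0"
    using assms conjugate_square_greater_0_vec by blast
  \<comment> \<open>The order on complex numbers compares only numbers with equal imaginary part, so
    positivity already makes \<open>v \<bullet>c v\<close> real.\<close>
  then have r: "v \<bullet>c v = of_real r" "r > 0"
    by (auto simp: r_def less_complex_def complex_eq_iff)
  define c :: complex where "c = of_real (1 / sqrt r)"
  have "(c \<cdot>\<^sub>v v) \<bullet>c (c \<cdot>\<^sub>v v) = c * cnj c * (v \<bullet>c v)"
    using assms by (simp add: conjugate_smult_vec)
  also have "\<dots> = of_real (1 / sqrt r * (1 / sqrt r) * r)"
    unfolding r c_def by (simp only: complex_cnj_complex_of_real of_real_mult)
  also have "1 / sqrt r * (1 / sqrt r) * r = 1"
    using r by simp
  finally have "(c \<cdot>\<^sub>v v) \<bullet>c (c \<cdot>\<^sub>v v) = 1" by simp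
  moreover have "c \<noteq> 0"
    using r by (simp add: c_def)
  ultimately show thesis using that by blast
qed

lemma orthonormal_basis_mat_iff:
  "orthonormal_basis_mat n U T \<longleftrightarrow>
    T \<in> carrier_mat (subspace_dim n U) n \<and> orthonormal_rows T \<and> vec_space.row_space n T = U"
  by (auto simp: orthonormal_basis_mat_def orthonormal_rows_def)

text \<open>\<open>gram_schmidt\<close> gives orthogonal vectors that are not normalized. Each is
  rescaled to length 1, and nonzero factors do not change the span.\<close>

lemma orthonormal_basis_mat_exists:
  assumes U: "vec_subspace n U"
  shows "\<exists>T. orthonormal_basis_mat n U T"
proof -
  interpret vec_space "TYPE(complex)" n .
  interpret cof_vec_space n "TYPE(complex)" .
  obtain A where A: "finite A" "A \<subseteq> U" "lin_indpt A" "span A = U"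
    using subspace_basis_exists[OF U] .
  obtain ws where ws: "set ws = A" "distinct ws"
    using finite_distinct_list[OF A(1)] by blast
  have wsc: "set ws \<subseteq> carrier_vec n"
    using A ws U by (auto simp: vec_subspace_iff)
  define us where "us = gram_schmidt n ws"
  have us: "span (set us) = U" "corthogonal us" "set us \<subseteq> carrier_vec n"
    using gram_schmidt_result[OF wsc ws(2) _ us_def] A ws by auto
  have "\<exists>c. c \<noteq> 0 \<and> (c \<cdot>\<^sub>v us ! i) \<bullet>c (c \<cdot>\<^sub>v us ! i) = 1" if i: "i < length us" for i
  proof -
    have "us ! i \<in> carrier_vec n"
      using us(3) i by auto
    \<comment> \<open>For a \<open>corthogonal\<close> list, the product of two entries vanishes
      exactly when their indices differ, so no entry is zero.\<close>
    moreover from this have "us ! i \<noteq> 0\<^sub>v n"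
      using corthogonalD[OF us(2) i i] by auto
    ultimately show ?thesis
      using exists_normalizing_factor by metis
  qed
  then obtain c where c: "\<And>i. i < length us \<Longrightarrow> c i \<noteq> 0"
    "\<And>i. i < length us \<Longrightarrow> (c i \<cdot>\<^sub>v us ! i) \<bullet>c (c i \<cdot>\<^sub>v us ! i) = 1"
    by metis
  define vs where "vs = map (\<lambda>i. c i \<cdot>\<^sub>v us ! i) [0..<length us]"
  have usc: "us ! i \<in> carrier_vec n" if "i < length us" for i
    using us(3) that by auto
  have vsc: "set vs \<subseteq> carrier_vec n"
    using usc by (auto simp: vs_def)
  define T where "T = mat_of_rows n vs"
  have T: "T \<in> carrier_mat (length us) n"
    by (intro carrier_matI) (simp_all add: T_def vs_def)
  have row: "row T i = c i \<cdot>\<^sub>v us ! i" if "i < length us" for i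
    using that usc by (simp add: T_def vs_def)
  have on: "orthonormal_rows T"
    unfolding orthonormal_rows_def
  proof (intro allI impI)
    fix i j assume "i < dim_row T" "j < dim_row T"
    then have ij: "i < length us" "j < length us" using T by auto
    show "row T i \<bullet>c row T j = (if i = j then 1 else 0)"
    proof (cases "i = j")
      case False
      then have "us ! i \<bullet>c us ! j = 0"
        using corthogonalD[OF us(2) ij] by simp
      then show ?thesis
        using False ij usc[OF ij(1)] usc[OF ij(2)] by (simp add: row conjugate_smult_vec)
    qed (use ij c row in auto)
  qed
  have "span (set vs) \<subseteq> span (set us)"
  proof (rule span_subsetI[OF us(3)], rule subsetI)
    fix v assume "v \<in> set vs"
    then obtain i where i: "i < length us" "v = c i \<cdot>\<^sub>v us ! i" by (auto simp: vs_def)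
    then have "us ! i \<in> span (set us)"
      using subsetD[OF in_own_span[OF us(3)]] by simp
    then show "v \<in> span (set us)"
      unfolding i(2) by (rule smult_in_span[OF us(3)])
  qed
  moreover have "span (set us) \<subseteq> span (set vs)"
  proof (rule span_subsetI[OF vsc], rule subsetI)
    fix u assume "u \<in> set us"
    then obtain i where i: "i < length us" "u = us ! i" by (auto simp: in_set_conv_nth)
    then have u: "u = inverse (c i) \<cdot>\<^sub>v (c i \<cdot>\<^sub>v us ! i)"
      using c(1) by (simp add: smult_smult_assoc)
    have "c i \<cdot>\<^sub>v us ! i \<in> span (set vs)"
      using i by (intro subsetD[OF in_own_span[OF vsc]]) (auto simp: vs_def)
    then show "u \<in> span (set vs)"
      unfolding u by (rule smult_in_span[OF vsc])
  qed
  ultimately have "row_space T = U"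
    using us(1) vsc by (simp add: row_space_def T_def)
  then have "orthonormal_basis_mat n U T"
    using subspace_dim_row_space[OF on T] T on by (simp add: orthonormal_basis_mat_iff)
  then show ?thesis ..
qed

text \<open>The later arguments use only these facts about the chosen matrix. The last one
  parametrizes U by coordinate vectors y, sent to y T.\<close>

lemma basis_mat_props:
  assumes "vec_subspace n U"
  shows "basis_mat n U \<in> carrier_mat (subspace_dim n U) n"
    and "orthonormal_rows (basis_mat n U)"
    and "U = {(basis_mat n U)\<^sup>T *\<^sub>v y | y. y \<in> carrier_vec (subspace_dim n U)}"
proof -
  have "orthonormal_basis_mat n U (basis_mat n U)"
    unfolding basis_mat_def using orthonormal_basis_mat_exists[OF assms] by (rule someI_ex)
  then have T: "basis_mat n U \<in> carrier_mat (subspace_dim n U) n" "orthonormal_rows (basis_mat n U)"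
    and U: "vec_space.row_space n (basis_mat n U) = U"
    by (auto simp: orthonormal_basis_mat_iff)
  show "basis_mat n U \<in> carrier_mat (subspace_dim n U) n" "orthonormal_rows (basis_mat n U)"
    by (fact T)+
  have "(basis_mat n U)\<^sup>T *\<^sub>v y \<in> carrier_vec n" if "y \<in> carrier_vec (subspace_dim n U)" for y
    using T(1) that by (intro mult_mat_vec_carrier) auto
  then have "{w \<in> carrier_vec n. \<exists>y\<in>carrier_vec (subspace_dim n U). (basis_mat n U)\<^sup>T *\<^sub>v y = w} =
      {(basis_mat n U)\<^sup>T *\<^sub>v y | y. y \<in> carrier_vec (subspace_dim n U)}"
    by blast
  with vec_space.row_space_eq[OF T(1)]
  show "U = {(basis_mat n U)\<^sup>T *\<^sub>v y | y. y \<in> carrier_vec (subspace_dim n U)}"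
    unfolding U carrier_matD[OF T(1)] by (rule trans)
qed

text \<open>With Q an orthonormal basis matrix of V, the projection of x is v = x Q^* Q. The
  remainder x - v has zero Q-coordinates, so it is orthogonal to every z Q, that is, to all of
  V.\<close>

lemma orthogonal_decomposition:
  assumes V: "vec_subspace d V" and x: "x \<in> carrier_vec d"
  shows "\<exists>v\<in>V. \<exists>w\<in>carrier_vec d. x = v + w \<and> (\<forall>y\<in>V. y \<bullet>c w = 0)"
proof -
  let ?Q = "basis_mat d V" and ?k = "subspace_dim d V"
  note Q = basis_mat_props[OF V]
  define p where "p = (mat_adjoint ?Q)\<^sup>T *\<^sub>v x"
  have p: "p \<in> carrier_vec ?k"
    unfolding p_def using Q(1) x by (intro mult_mat_vec_carrier) auto
  define v where "v = ?Q\<^sup>T *\<^sub>v p"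
  have v: "v \<in> carrier_vec d" "v \<in> V"
    using Q p by (auto simp: v_def)
  have "y \<bullet>c (x - v) = 0" if y: "y \<in> V" for y
  proof -
    obtain z where z: "z \<in> carrier_vec ?k" "y = ?Q\<^sup>T *\<^sub>v z"
      using y Q(3) by blast
    have "(mat_adjoint ?Q)\<^sup>T *\<^sub>v (x - v) = p - (mat_adjoint ?Q)\<^sup>T *\<^sub>v v"
      unfolding p_def using Q(1) x v(1) by (intro mult_minus_distrib_mat_vec) auto
    also have "\<dots> = 0\<^sub>v ?k"
      using orthonormal_rows_coisometry[OF Q(2,1) p] p by (simp add: v_def)
    finally have "(mat_adjoint ?Q)\<^sup>T *\<^sub>v (x - v) = 0\<^sub>v ?k" .
    then show ?thesis
      using cscalar_prod_mult_mat_vec[of "?Q\<^sup>T" d ?k z "x - v"] Q(1) x v(1) z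
      by (simp add: mat_adjoint_transpose)
  qed
  moreover have "x = v + (x - v)"
    using v x by (intro eq_vecI) auto
  moreover have "x - v \<in> carrier_vec d"
    using v x by simp
  ultimately show ?thesis
    using v(2) by blast
qed

section \<open>Column norms and the support bound\<close>

text \<open>Bessel's inequality for the j-th unit vector: t is the coordinate vector of its
  projection onto the row space, and y is that projection. Both the entry of y at j and the squared
  norm of y equal c, so c^2 is at most c.\<close>

lemma orthonormal_rows_column_norm_le:
  assumes T: "orthonormal_rows T" "T \<in> carrier_mat d n" and j: "j < n"
  shows "(\<Sum>i<d. (cmod (T $$ (i, j)))\<^sup>2) \<le> 1"
proof -
  define c where "c = (\<Sum>i<d. (cmod (T $$ (i, j)))\<^sup>2)"
  define t where "t = conjugate (col T j)"
  have t: "t \<in> carrier_vec d" "\<And>i. i < d \<Longrightarrow> t $ i = cnj (T $$ (i, j))"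
    using T j by (auto simp: t_def)
  define y where "y = T\<^sup>T *\<^sub>v t"
  have y: "y \<in> carrier_vec n"
    unfolding y_def using T t by (intro mult_mat_vec_carrier) auto
  have yj: "y $ j = of_real c"
    using T t j
    by (auto simp: y_def c_def scalar_prod_def lessThan_atLeast0 complex_norm_square
        simp flip: of_real_power intro!: sum.cong)
  have "of_real c = t \<bullet>c t"
    using t by (auto simp: c_def scalar_prod_def lessThan_atLeast0 complex_norm_square
        simp flip: of_real_power intro!: sum.cong)
  also have "\<dots> = y \<bullet>c y"
    unfolding y_def using orthonormal_rows_isometry[OF T t(1) t(1)] ..
  also have "\<dots> = of_real (\<Sum>k<n. (cmod (y $ k))\<^sup>2)"
    using y by (auto simp: scalar_prod_def lessThan_atLeast0 complex_norm_square
        simp flip: of_real_power intro!: sum.cong)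
  finally have "c = (\<Sum>k<n. (cmod (y $ k))\<^sup>2)"
    by (simp only: of_real_eq_iff)
  moreover have "(cmod (y $ j))\<^sup>2 \<le> (\<Sum>k<n. (cmod (y $ k))\<^sup>2)"
    using j by (intro member_le_sum) auto
  moreover have "(cmod (y $ j))\<^sup>2 = c\<^sup>2"
    unfolding yj by simp
  ultimately have "c\<^sup>2 \<le> c"
    by linarith
  have "c \<le> 1"
  proof (rule ccontr)
    assume "\<not> c \<le> 1"
    then have "1 * c < c * c"
      by (intro mult_strict_right_mono) auto
    then show False
      using \<open>c\<^sup>2 \<le> c\<close> by (simp add: power2_eq_square)
  qed
  then show ?thesis by (simp add: c_def)
qed

text \<open>The squared Frobenius norm is \<open>d\<close> when summed by rows and at most \<open>card S\<close> by columns.\<close>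

lemma orthonormal_rows_le_card_support:
  assumes T: "orthonormal_rows T" "T \<in> carrier_mat d n"
    and S: "S \<subseteq> {..<n}" "\<And>i j. i < d \<Longrightarrow> j < n \<Longrightarrow> j \<notin> S \<Longrightarrow> T $$ (i, j) = 0"
  shows "d \<le> card S"
proof -
  have row: "(\<Sum>j<n. (cmod (T $$ (i, j)))\<^sup>2) = 1" if i: "i < d" for i
  proof -
    have "of_real (\<Sum>j<n. (cmod (T $$ (i, j)))\<^sup>2) = row T i \<bullet>c row T i"
      using T i by (auto simp: scalar_prod_def lessThan_atLeast0 complex_norm_square
          simp flip: of_real_power intro!: sum.cong)
    also have "\<dots> = of_real 1"
      using T i by (simp add: orthonormal_rows_def)
    finally show ?thesis by (simp only: of_real_eq_iff)
  qed
  have "real d = (\<Sum>i<d. \<Sum>j<n. (cmod (T $$ (i, j)))\<^sup>2)"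
    using row by simp
  also have "\<dots> = (\<Sum>j<n. \<Sum>i<d. (cmod (T $$ (i, j)))\<^sup>2)"
    by (rule sum.swap)
  also have "\<dots> = (\<Sum>j\<in>S. \<Sum>i<d. (cmod (T $$ (i, j)))\<^sup>2)"
    using S by (intro sum.mono_neutral_right) auto
  also have "\<dots> \<le> (\<Sum>j\<in>S. 1)"
    using S orthonormal_rows_column_norm_le[OF T] by (intro sum_mono) auto
  finally show ?thesis by simp
qed

section \<open>Coordinate subspaces\<close>

definition coordinate_subspace :: "nat \<Rightarrow> nat set \<Rightarrow> complex vec set" where
  "coordinate_subspace n S = {x \<in> carrier_vec n. \<forall>i<n. i \<notin> S \<longrightarrow> x $ i = 0}"

lemma vec_subspace_coordinate_subspace: "vec_subspace n (coordinate_subspace n S)"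
  by (auto simp: vec_subspace_iff coordinate_subspace_def)

lemma unit_vec_in_coordinate_subspace:
  "i \<in> S \<Longrightarrow> unit_vec n i \<in> coordinate_subspace n S"
  by (auto simp: coordinate_subspace_def unit_vec_def)

text \<open>The unit vectors indexed by an enumeration of S are the rows of an orthonormal matrix
  whose row space is the coordinate subspace.\<close>

lemma subspace_dim_coordinate_subspace:
  assumes S: "S \<subseteq> {..<n}"
  shows "subspace_dim n (coordinate_subspace n S) = card S"
proof -
  obtain xs where xs: "set xs = S" "distinct xs"
    using finite_distinct_list[OF finite_subset[OF S]] by auto
  let ?m = "length xs"
  have nth: "xs ! k < n" if "k < ?m" for k
    using that xs S nth_mem by blast
  define T :: "complex mat" where "T = mat_of_rows n (map (unit_vec n) xs)"
  have T: "T \<in> carrier_mat ?m n"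
    by (intro carrier_matI) (simp_all add: T_def)
  have row: "row T k = unit_vec n (xs ! k)" if "k < ?m" for k
    using that by (simp add: T_def)
  have on: "orthonormal_rows T"
    using T nth xs by (auto simp: orthonormal_rows_def row nth_eq_iff_index_eq)
  \<comment> \<open>The sum has one possibly nonzero term if i is in S, since \<open>xs\<close> is
    distinct, and none otherwise.\<close>
  have Ty: "(T\<^sup>T *\<^sub>v y) $ i = (\<Sum>k<?m. if xs ! k = i then y $ k else 0)"
    if "y \<in> carrier_vec ?m" "i < n" for y i
    using that T nth
    by (auto simp: scalar_prod_def lessThan_atLeast0 T_def mat_of_rows_index unit_vec_def
        intro!: sum.cong)
  have "vec_space.row_space n T = coordinate_subspace n S"
    unfolding vec_space.row_space_eq[OF T]
  proof (intro equalityI subsetI, goal_cases)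
    case (1 x)
    then obtain y where y: "y \<in> carrier_vec ?m" "T\<^sup>T *\<^sub>v y = x" "x \<in> carrier_vec n"
      using T by auto
    have "x $ i = 0" if "i < n" "i \<notin> S" for i
      using Ty[OF y(1) that(1)] that xs unfolding y(2) by (auto intro!: sum.neutral)
    then show ?case
      using y by (simp add: coordinate_subspace_def)
  next
    case (2 x)
    define y where "y = vec ?m (\<lambda>k. x $ (xs ! k))"
    have y: "y \<in> carrier_vec ?m" by (simp add: y_def)
    have "T\<^sup>T *\<^sub>v y = x"
    proof (rule eq_vecI)
      fix i assume "i < dim_vec x"
      then have i: "i < n" using 2 by (auto simp: coordinate_subspace_def)
      show "(T\<^sup>T *\<^sub>v y) $ i = x $ i"
      proof (cases "i \<in> S")
        case True
        then obtain k0 where k0: "k0 < ?m" "xs ! k0 = i"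
          using xs by (metis in_set_conv_nth)
        have "(T\<^sup>T *\<^sub>v y) $ i = (\<Sum>k<?m. if k = k0 then y $ k else 0)"
          unfolding Ty[OF y i] using k0 xs nth_eq_iff_index_eq
          by (intro sum.cong) auto
        also have "\<dots> = x $ i"
          using k0 by (simp add: y_def)
        finally show ?thesis .
      next
        case False
        then have "x $ i = 0"
          using 2 i by (auto simp: coordinate_subspace_def)
        then show ?thesis
          using False xs unfolding Ty[OF y i] by (auto intro!: sum.neutral)
      qed
    qed (use T 2 in \<open>auto simp: coordinate_subspace_def\<close>)
    then show ?case
      using 2 y T by (auto simp: coordinate_subspace_def)
  qed
  then show ?thesis
    using subspace_dim_row_space[OF on T] xs distinct_card by metis
qed

section \<open>Compressions and the matrix space of a graph\<close>

text \<open>Lets the action of a compressed matrix be followed in the ambient space: embed by T,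
  apply B, return to coordinates by the adjoint.\<close>

lemma compression_mult_vec:
  assumes T: "T \<in> carrier_mat d n" and B: "B \<in> carrier_mat n n" and x: "x \<in> carrier_vec d"
  shows "(T * B * mat_adjoint T)\<^sup>T *\<^sub>v x = (mat_adjoint T)\<^sup>T *\<^sub>v (B\<^sup>T *\<^sub>v (T\<^sup>T *\<^sub>v x))"
proof -
  have "(T * B * mat_adjoint T)\<^sup>T = (mat_adjoint T)\<^sup>T * (B\<^sup>T * T\<^sup>T)"
    using T B by (simp add: transpose_mult[of _ d n _ d] transpose_mult[of _ d n _ n])
  also have "\<dots> *\<^sub>v x = (mat_adjoint T)\<^sup>T *\<^sub>v ((B\<^sup>T * T\<^sup>T) *\<^sub>v x)"
    using T B x by (intro assoc_mult_mat_vec) auto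
  also have "(B\<^sup>T * T\<^sup>T) *\<^sub>v x = B\<^sup>T *\<^sub>v (T\<^sup>T *\<^sub>v x)"
    using T B x by (intro assoc_mult_mat_vec) auto
  finally show ?thesis .
qed

lemma elem_mat_in_graph_mat_space:
  assumes "(i, j) \<in> parcs G"
  shows "elem_mat n i j \<in> graph_mat_space n G"
proof -
  interpret matrix_vs n n "TYPE(complex)" .
  have "{elem_mat n i j | i j. (i, j) \<in> parcs G} \<subseteq> carrier_mat n n"
    by (auto simp: elem_mat_def)
  from in_own_span[OF this] show ?thesis
    using assms by (auto simp: graph_mat_space_def)
qed

text \<open>The matrices vanishing off the arcs form a submodule that contains the generators, hence
  also their span.\<close>

lemma graph_mat_spaceD:
  assumes "C \<in> graph_mat_space n G"
  shows "C \<in> carrier_mat n n"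
    and "i < n \<Longrightarrow> j < n \<Longrightarrow> (i, j) \<notin> parcs G \<Longrightarrow> C $$ (i, j) = 0"
proof -
  interpret matrix_vs n n "TYPE(complex)" .
  define N where "N = {C :: complex mat. C \<in> carrier_mat n n \<and>
    (\<forall>i<n. \<forall>j<n. (i, j) \<notin> parcs G \<longrightarrow> C $$ (i, j) = 0)}"
  have "submodule class_ring N V"
    using module_axioms
    by (auto simp: submodule_def N_def module_mat_simps class_ring_simps)
  moreover have "{elem_mat n i j | i j. (i, j) \<in> parcs G} \<subseteq> N"
    by (auto simp: elem_mat_def N_def)
  ultimately have "C \<in> N"
    using span_is_subset assms unfolding graph_mat_space_def by blast
  then show "C \<in> carrier_mat n n"
    and "i < n \<Longrightarrow> j < n \<Longrightarrow> (i, j) \<notin> parcs G \<Longrightarrow> C $$ (i, j) = 0"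
    by (auto simp: N_def)
qed

section \<open>Strong connectivity and closed vertex sets\<close>

text \<open>Trades paths for a set that no arc of the induced subgraph leaves, the combinatorial
  counterpart of an invariant subspace. If v is not reachable from u, the vertices reachable from u
  form such a set; conversely a path that starts in such a set stays in it.\<close>

lemma not_strongly_connected_iff:
  assumes "S \<noteq> {}"
  shows "\<not> strongly_connected (induce_subgraph (with_proj G) S) \<longleftrightarrow>
    (\<exists>A. A \<subseteq> S \<and> A \<noteq> {} \<and> A \<noteq> S \<and> (\<forall>i j. (i, j) \<in> parcs G \<longrightarrow> i \<in> A \<longrightarrow> j \<in> S \<longrightarrow> j \<in> A))"
    (is "\<not> strongly_connected ?H \<longleftrightarrow> ?R")
proof -
  have ends: "arcs_ends ?H = {(i, j) \<in> parcs G. i \<in> S \<and> j \<in> S}"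
    by (auto simp: arcs_ends_conv)
  show ?thesis
  proof
    assume "\<not> strongly_connected ?H"
    \<comment> \<open>Since S is nonempty, strong connectivity can fail only through an unreachable
      pair, not for lack of vertices.\<close>
    then obtain u v where uv: "u \<in> S" "v \<in> S" "\<not> u \<rightarrow>\<^sup>*\<^bsub>?H\<^esub> v"
      using assms by (auto simp: strongly_connected_def)
    let ?A = "{x. u \<rightarrow>\<^sup>*\<^bsub>?H\<^esub> x}"
    have sub: "?A \<subseteq> S"
      by (auto simp: reachable_def dest: in_rtrancl_on_in_F)
    moreover have "u \<in> ?A" "v \<notin> ?A"
      using uv by (auto simp: reachable_def)
    moreover have "j \<in> ?A" if "(i, j) \<in> parcs G" "i \<in> ?A" "j \<in> S" for i j
    proof -
      have "(i, j) \<in> arcs_ends ?H"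
        using that sub by (auto simp: ends)
      then show ?thesis
        using that by (auto simp: reachable_def intro: rtrancl_on_into_rtrancl_on)
    qed
    ultimately show ?R
      using uv by (intro exI[of _ ?A]) blast
  next
    assume ?R
    then obtain A where A: "A \<subseteq> S" "A \<noteq> {}" "A \<noteq> S"
      "\<And>i j. (i, j) \<in> parcs G \<Longrightarrow> i \<in> A \<Longrightarrow> j \<in> S \<Longrightarrow> j \<in> A"
      by blast
    then obtain u v where uv: "u \<in> A" "v \<in> S" "v \<notin> A" by blast
    have "x \<in> A" if "u \<rightarrow>\<^sup>*\<^bsub>?H\<^esub> x" for x
      using that unfolding reachable_def
      by (induction rule: rtrancl_on_induct) (use uv A(4) in \<open>auto simp: ends\<close>)
    then show "\<not> strongly_connected ?H"
      using uv A(1) by (auto simp: strongly_connected_def)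
  qed
qed

section \<open>From closed vertex sets to reducible compressions\<close>

lemma coordinate_compression_reducible:
  assumes S: "S \<subseteq> {..<n}" and A: "A \<subseteq> S" "A \<noteq> {}" "A \<noteq> S"
    and closed: "\<And>i j. (i, j) \<in> parcs G \<Longrightarrow> i \<in> A \<Longrightarrow> j \<in> S \<Longrightarrow> j \<in> A"
  shows "reducible_mats (card S) (compression n (graph_mat_space n G) (coordinate_subspace n S))"
proof -
  let ?U = "coordinate_subspace n S"
  define T where "T = basis_mat n ?U"
  have T: "T \<in> carrier_mat (card S) n" "orthonormal_rows T"
    and U: "?U = {T\<^sup>T *\<^sub>v y | y. y \<in> carrier_vec (card S)}"
    using basis_mat_props[OF vec_subspace_coordinate_subspace, of n S]
    by (simp_all only: T_def subspace_dim_coordinate_subspace[OF S])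
  \<comment> \<open>The basis matrix of \<open>?U\<close> is an arbitrary choice, so V is described
    by its ambient image: the coordinates of vectors supported on A. Unit vectors at points of A and
    of S - A then show that V is nonzero and proper.\<close>
  define V where "V = {v \<in> carrier_vec (card S). T\<^sup>T *\<^sub>v v \<in> coordinate_subspace n A}"
  have preimage: "\<exists>y \<in> carrier_vec (card S). T\<^sup>T *\<^sub>v y = unit_vec n i" if "i \<in> S" for i
    using unit_vec_in_coordinate_subspace[OF that, of n] unfolding U by force
  have T0: "T\<^sup>T *\<^sub>v 0\<^sub>v (card S) = 0\<^sub>v n"
    using T by (intro eq_vecI) auto
  then have "vec_subspace (card S) V"
    using T vec_subspace_coordinate_subspace[of n A]
    by (auto simp: vec_subspace_iff V_def mult_add_distrib_mat_vec[of _ n "card S"]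
        mult_mat_vec[of _ n "card S"])
  moreover have "V \<noteq> {0\<^sub>v (card S)}"
  proof -
    obtain i where i: "i \<in> A" using A by blast
    then obtain y where y: "y \<in> carrier_vec (card S)" "T\<^sup>T *\<^sub>v y = unit_vec n i"
      using preimage A by blast
    have "i < n" using i A S by auto
    then have "y \<noteq> 0\<^sub>v (card S)"
      using y T0 unit_vec_nonzero[of i n] by metis
    moreover have "y \<in> V"
      using y unit_vec_in_coordinate_subspace[OF i, of n] by (simp add: V_def)
    ultimately show ?thesis by blast
  qed
  moreover have "V \<noteq> carrier_vec (card S)"
  proof -
    obtain i where i: "i \<in> S" "i \<notin> A" using A by blast
    then obtain y where y: "y \<in> carrier_vec (card S)" "T\<^sup>T *\<^sub>v y = unit_vec n i"
      using preimage by blast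
    have "i < n" using i S by auto
    then have "y \<notin> V"
      using y i by (auto simp: V_def coordinate_subspace_def)
    then show ?thesis using y by blast
  qed
  moreover have "B\<^sup>T *\<^sub>v v \<in> V" if v: "v \<in> V" and B: "B \<in> compression n (graph_mat_space n G) ?U" for v B
  proof -
    obtain C where C: "C \<in> graph_mat_space n G" "B = T * C * mat_adjoint T"
      using B by (auto simp: compression_def T_def)
    note Cn = graph_mat_spaceD(1)[OF C(1)]
    define a where "a = T\<^sup>T *\<^sub>v v"
    have vc: "v \<in> carrier_vec (card S)" and a: "a \<in> coordinate_subspace n A"
      using v by (auto simp: V_def a_def)
    then have ac: "a \<in> carrier_vec n" by (simp add: coordinate_subspace_def)
    define z where "z = C\<^sup>T *\<^sub>v a"
    have z: "z \<in> carrier_vec n"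
      unfolding z_def using Cn ac by (intro mult_mat_vec_carrier) auto
    \<comment> \<open>Entry i of z sums \<open>C $$ (k, i) * a $ k\<close>: for k in A there is no
      arc to i, and for k outside A the entry of a is zero.\<close>
    have zi: "z $ i = 0" if "i \<in> S" "i \<notin> A" for i
    proof -
      have i: "i < n" using that S by auto
      have "C $$ (k, i) * a $ k = 0" if k: "k < n" for k
      proof (cases "k \<in> A")
        case True
        then have "(k, i) \<notin> parcs G"
          using closed \<open>i \<in> S\<close> \<open>i \<notin> A\<close> by blast
        then show ?thesis
          using graph_mat_spaceD(2)[OF C(1) k i] by simp
      next
        case False
        then show ?thesis using a k by (simp add: coordinate_subspace_def)
      qed
      then show ?thesis
        using i Cn ac by (auto simp: z_def scalar_prod_def intro!: sum.neutral)
    qed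
    define w where "w = B\<^sup>T *\<^sub>v v"
    have w: "w = (mat_adjoint T)\<^sup>T *\<^sub>v z"
      unfolding w_def C(2) z_def a_def using T Cn vc by (intro compression_mult_vec)
    have wc: "w \<in> carrier_vec (card S)"
      unfolding w using T z by (intro mult_mat_vec_carrier) auto
    have Tw: "T\<^sup>T *\<^sub>v w \<in> ?U"
      using wc unfolding U by blast
    \<comment> \<open>The vector z may have entries outside S. Returning to coordinates projects it
      onto \<open>?U\<close>: entries outside S become zero, and those on S are kept, as pairing
      with unit vectors shows.\<close>
    have "(T\<^sup>T *\<^sub>v w) $ i = 0" if i: "i < n" "i \<notin> A" for i
    proof (cases "i \<in> S")
      case False
      then show ?thesis using Tw i by (simp add: coordinate_subspace_def)
    next
      case True
      then obtain y where y: "y \<in> carrier_vec (card S)" "T\<^sup>T *\<^sub>v y = unit_vec n i"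
        using preimage by blast
      have "(T\<^sup>T *\<^sub>v w) $ i = (T\<^sup>T *\<^sub>v w) \<bullet>c unit_vec n i"
        using Tw i by (simp add: scalar_prod_def coordinate_subspace_def unit_vec_def if_distrib
            cong: if_cong)
      also have "\<dots> = w \<bullet>c y"
        using orthonormal_rows_isometry[OF T(2,1) wc y(1)] by (simp add: y)
      also have "\<dots> = z \<bullet>c unit_vec n i"
        unfolding w y(2)[symmetric]
        using cscalar_prod_mult_mat_vec[of "(mat_adjoint T)\<^sup>T" "card S" n z y] T z y
        by (simp add: mat_adjoint_transpose)
      also have "\<dots> = z $ i"
        using z i by (simp add: scalar_prod_def unit_vec_def if_distrib cong: if_cong)
      finally show ?thesis using zi[OF True i(2)] by simp
    qed
    then show ?thesis
      using wc Tw by (simp add: V_def coordinate_subspace_def w_def)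
  qed
  ultimately show ?thesis
    unfolding reducible_mats_def by blast
qed

section \<open>From reducible compressions to induced subgraphs\<close>

lemma compression_reducible_imp_not_strongly_connected:
  assumes U: "vec_subspace n U"
    and red: "reducible_mats (subspace_dim n U) (compression n (graph_mat_space n G) U)"
  obtains S where "S \<subseteq> {..<n}" "S \<noteq> {}" "subspace_dim n U \<le> card S"
    "\<not> strongly_connected (induce_subgraph (with_proj G) S)"
proof -
  define d where "d = subspace_dim n U"
  define T where "T = basis_mat n U"
  have T: "T \<in> carrier_mat d n" "orthonormal_rows T"
    using basis_mat_props[OF U] by (simp_all add: T_def d_def)
  obtain V where V: "vec_subspace d V" "V \<noteq> {0\<^sub>v d}" "V \<noteq> carrier_vec d"
    and inv: "\<And>v B. v \<in> V \<Longrightarrow> B \<in> compression n (graph_mat_space n G) U \<Longrightarrow> B\<^sup>T *\<^sub>v v \<in> V"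
    using red unfolding reducible_mats_def d_def by blast
  have Vc: "v \<in> carrier_vec d" if "v \<in> V" for v
    using V(1) that by (auto simp: vec_subspace_iff)
  \<comment> \<open>The complement is taken in coordinates; T is isometric, so its image is the
    orthogonal complement of the image of V inside U.\<close>
  define W where "W = {w \<in> carrier_vec d. \<forall>v\<in>V. v \<bullet>c w = 0}"
  have Tc: "T\<^sup>T *\<^sub>v x \<in> carrier_vec n" if "x \<in> carrier_vec d" for x
    using T that by (intro mult_mat_vec_carrier) auto
  have decomp: "\<exists>v\<in>V. \<exists>w\<in>W. x = v + w" if x: "x \<in> carrier_vec d" for x
    using orthogonal_decomposition[OF V(1) x] by (auto simp: W_def)
  have nonzero: "\<exists>i<n. (T\<^sup>T *\<^sub>v x) $ i \<noteq> 0" if x: "x \<in> carrier_vec d" "x \<noteq> 0\<^sub>v d" for x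
  proof (rule ccontr)
    assume "\<not> ?thesis"
    then have "T\<^sup>T *\<^sub>v x = 0\<^sub>v n"
      using Tc[OF x(1)] T by (intro eq_vecI) auto
    then have "(T\<^sup>T *\<^sub>v x) \<bullet>c (T\<^sup>T *\<^sub>v x) = 0"
      by simp
    then show False
      using orthonormal_rows_isometry[OF T(2,1) x(1) x(1)] x by simp
  qed
  define A where "A = {i. i < n \<and> (\<exists>v\<in>V. (T\<^sup>T *\<^sub>v v) $ i \<noteq> 0)}"
  define B where "B = {i. i < n \<and> (\<exists>w\<in>W. (T\<^sup>T *\<^sub>v w) $ i \<noteq> 0)}"
  have "A \<noteq> {}"
  proof -
    obtain v where "v \<in> V" "v \<noteq> 0\<^sub>v d"
      using V by (auto simp: vec_subspace_iff)
    then show ?thesis using nonzero Vc unfolding A_def by blast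
  qed
  have "B \<noteq> {}"
  proof -
    obtain x where x: "x \<in> carrier_vec d" "x \<notin> V"
      using V Vc by blast
    obtain v w where vw: "v \<in> V" "w \<in> W" "x = v + w"
      using decomp x by blast
    have "w \<noteq> 0\<^sub>v d" using vw x Vc by auto
    then show ?thesis using nonzero vw(2) unfolding B_def W_def by blast
  qed
  \<comment> \<open>The elementary matrix of an arc (i, j) sends a = v T to a multiple of the j-th
    unit vector with factor \<open>a $ i\<close>. By invariance its compression is orthogonal to w,
    so \<open>a $ i\<close> times the conjugate of entry j of w T is zero, against the choice of v
    and w.\<close>
  have no_arc: "j \<notin> B" if arc: "(i, j) \<in> parcs G" and i: "i \<in> A" for i j
  proof
    assume j: "j \<in> B"
    obtain v where v: "v \<in> V" "(T\<^sup>T *\<^sub>v v) $ i \<noteq> 0" using i by (auto simp: A_def)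
    obtain w where w: "w \<in> W" "(T\<^sup>T *\<^sub>v w) $ j \<noteq> 0" using j by (auto simp: B_def)
    have wc: "w \<in> carrier_vec d" using w by (simp add: W_def)
    have ij: "i < n" "j < n" using i j by (auto simp: A_def B_def)
    let ?E = "elem_mat n i j"
    define a where "a = T\<^sup>T *\<^sub>v v"
    have ac: "a \<in> carrier_vec n" using Tc Vc v by (simp add: a_def)
    have E: "?E \<in> carrier_mat n n" by (simp add: elem_mat_def)
    have Ea: "?E\<^sup>T *\<^sub>v a = a $ i \<cdot>\<^sub>v unit_vec n j"
      using ac ij by (auto simp: elem_mat_def scalar_prod_def if_distrib if_distribR cong: if_cong
          intro!: eq_vecI)
    have "T * ?E * mat_adjoint T \<in> compression n (graph_mat_space n G) U"
      using elem_mat_in_graph_mat_space[OF arc] by (auto simp: compression_def T_def)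
    then have "(T * ?E * mat_adjoint T)\<^sup>T *\<^sub>v v \<in> V"
      using inv v by blast
    then have "(mat_adjoint T)\<^sup>T *\<^sub>v (?E\<^sup>T *\<^sub>v a) \<in> V"
      using compression_mult_vec[OF T(1) E Vc[OF v(1)]] by (simp add: a_def)
    then have "0 = ((mat_adjoint T)\<^sup>T *\<^sub>v (?E\<^sup>T *\<^sub>v a)) \<bullet>c w"
      using w by (simp add: W_def)
    also have "\<dots> = (?E\<^sup>T *\<^sub>v a) \<bullet>c (T\<^sup>T *\<^sub>v w)"
      using cscalar_prod_mult_mat_vec[of "(mat_adjoint T)\<^sup>T" d n "?E\<^sup>T *\<^sub>v a" w] T E ac wc
      by (simp add: mat_adjoint_transpose Ea)
    also have "\<dots> = a $ i * cnj ((T\<^sup>T *\<^sub>v w) $ j)"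
    proof -
      have c: "conjugate (T\<^sup>T *\<^sub>v w) \<in> carrier_vec n"
        using Tc[OF wc] by (rule carrier_vec_conjugate)
      show ?thesis
        unfolding Ea smult_scalar_prod_distrib[OF unit_vec_carrier c]
        using T ij by (simp add: scalar_prod_left_unit[OF c])
    qed
    finally show False using v w by (simp add: a_def)
  qed
  \<comment> \<open>Otherwise A is a singleton {k} with k in B, and the inner product of v T and w T
    reduces to its nonzero term at k, although v and w are orthogonal.\<close>
  have "\<exists>u\<in>A. \<exists>u'\<in>B. u \<noteq> u'"
  proof (rule ccontr)
    assume "\<not> ?thesis"
    then have eq: "u = u'" if "u \<in> A" "u' \<in> B" for u u'
      using that by simp
    obtain k where k: "k \<in> A" "k \<in> B"
      using \<open>A \<noteq> {}\<close> \<open>B \<noteq> {}\<close> eq by (metis all_not_in_conv)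
    have A: "i = k" if "i \<in> A" for i
      using eq[OF that k(2)] .
    obtain v where v: "v \<in> V" "(T\<^sup>T *\<^sub>v v) $ k \<noteq> 0" using k(1) by (auto simp: A_def)
    obtain w where w: "w \<in> W" "(T\<^sup>T *\<^sub>v w) $ k \<noteq> 0" using k(2) by (auto simp: B_def)
    have kn: "k < n" using k(1) by (auto simp: A_def)
    have wc: "w \<in> carrier_vec d" using w by (simp add: W_def)
    have zero: "(T\<^sup>T *\<^sub>v v) $ i = 0" if "i < n" "i \<noteq> k" for i
      using A[of i] that v(1) unfolding A_def by auto
    have "0 = v \<bullet>c w"
      using v w by (simp add: W_def)
    also have "\<dots> = (T\<^sup>T *\<^sub>v v) \<bullet>c (T\<^sup>T *\<^sub>v w)"
      using orthonormal_rows_isometry[OF T(2,1) Vc[OF v(1)] wc] by simp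
    also have "\<dots> = (\<Sum>i\<in>{0..<n}. (T\<^sup>T *\<^sub>v v) $ i * cnj ((T\<^sup>T *\<^sub>v w) $ i))"
      unfolding scalar_prod_def using T by (intro sum.cong) auto
    also have "\<dots> = (\<Sum>i\<in>{k}. (T\<^sup>T *\<^sub>v v) $ i * cnj ((T\<^sup>T *\<^sub>v w) $ i))"
      using kn zero by (intro sum.mono_neutral_right) auto
    finally show False using v w by simp
  qed
  then obtain u u' where u: "u \<in> A" "u' \<in> B" "u \<noteq> u'" by blast
  let ?S = "A \<union> B"
  have S: "?S \<subseteq> {..<n}" by (auto simp: A_def B_def)
  \<comment> \<open>Row i of T is the image of the i-th unit vector, whose components in V and W
    both have images vanishing outside \<open>?S\<close>.\<close>
  have "T $$ (i, j) = 0" if i: "i < d" and j: "j < n" "j \<notin> ?S" for i j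
  proof -
    obtain v w where vw: "v \<in> V" "w \<in> W" "unit_vec d i = v + w"
      using decomp unit_vec_carrier by blast
    have c: "v \<in> carrier_vec d" "w \<in> carrier_vec d"
      using vw Vc by (auto simp: W_def)
    have "T $$ (i, j) = (T\<^sup>T *\<^sub>v unit_vec d i) $ j"
      using T i j by simp
    also have "\<dots> = (T\<^sup>T *\<^sub>v v) $ j + (T\<^sup>T *\<^sub>v w) $ j"
      unfolding vw(3) using T c j Tc by (simp add: mult_add_distrib_mat_vec[of _ n d])
    also have "\<dots> = 0"
      using vw(1,2) j by (auto simp: A_def B_def)
    finally show ?thesis .
  qed
  then have "d \<le> card ?S"
    using orthonormal_rows_le_card_support[OF T(2,1) S] by blast
  moreover have "\<not> strongly_connected (induce_subgraph (with_proj G) ?S)"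
  proof (subst not_strongly_connected_iff)
    show "\<exists>A'. A' \<subseteq> ?S \<and> A' \<noteq> {} \<and> A' \<noteq> ?S \<and>
        (\<forall>i j. (i, j) \<in> parcs G \<longrightarrow> i \<in> A' \<longrightarrow> j \<in> ?S \<longrightarrow> j \<in> A')"
    \<comment> \<open>An arc from this subset of A cannot end in B, so inside \<open>?S\<close> it
      ends in A - B. Adding u keeps the set nonempty even when A is contained in B.\<close>
    proof (intro exI[of _ "insert u (A - B)"] conjI allI impI)
      have "u' \<notin> insert u (A - B)" "u' \<in> ?S"
        using u by simp_all
      then show "insert u (A - B) \<noteq> ?S"
        by metis
      show "j \<in> insert u (A - B)"
        if "(i, j) \<in> parcs G" "i \<in> insert u (A - B)" "j \<in> ?S" for i j
        using that u(1) no_arc[of i j] by auto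
    qed (use u in auto)
  qed (use u in blast)
  ultimately show thesis
    using that[of ?S] S u unfolding d_def by blast
qed

section \<open>Equality of the two maxima\<close>

theorem theorem1p14:
  fixes n :: nat and G :: "nat pair_pre_digraph"
  assumes "pair_wf_digraph G" and "pverts G = {0..<n}"
  shows "(non_strong_orders G = {} \<longleftrightarrow> reducible_dims n (graph_mat_space n G) = {}) \<and>
    Max (non_strong_orders G) = Max (reducible_dims n (graph_mat_space n G))"
proof -
  let ?N = "non_strong_orders G" and ?R = "reducible_dims n (graph_mat_space n G)"
  have V: "pverts G = {..<n}"
    by (simp add: assms(2) atLeast0LessThan)
  have NR: "?N \<subseteq> ?R"
  proof
    fix k assume "k \<in> ?N"
    then obtain S where S: "k = card S" "S \<subseteq> {..<n}" "S \<noteq> {}"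
      "\<not> strongly_connected (induce_subgraph (with_proj G) S)"
      by (auto simp: non_strong_orders_def V)
    then obtain A where "A \<subseteq> S" "A \<noteq> {}" "A \<noteq> S"
      "\<And>i j. (i, j) \<in> parcs G \<Longrightarrow> i \<in> A \<Longrightarrow> j \<in> S \<Longrightarrow> j \<in> A"
      unfolding not_strongly_connected_iff[OF S(3)] by blast
    from coordinate_compression_reducible[OF S(2) this] show "k \<in> ?R"
      using vec_subspace_coordinate_subspace[of n S] subspace_dim_coordinate_subspace[OF S(2)] S(1)
      unfolding reducible_dims_def by force
  qed
  \<comment> \<open>Only domination is obtained, as S may have more than d elements; with the
    inclusion \<open>NR\<close> this suffices for the maxima.\<close>
  have RN: "\<exists>k\<in>?N. d \<le> k" if d: "d \<in> ?R" for d
  proof -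
    obtain U where U: "d = subspace_dim n U" "vec_subspace n U"
      "reducible_mats (subspace_dim n U) (compression n (graph_mat_space n G) U)"
      using d by (auto simp: reducible_dims_def)
    obtain S where S: "S \<subseteq> {..<n}" "S \<noteq> {}" "d \<le> card S"
      "\<not> strongly_connected (induce_subgraph (with_proj G) S)"
      using compression_reducible_imp_not_strongly_connected[OF U(2,3)] unfolding U(1) by metis
    then have "card S \<in> ?N"
      by (auto simp: non_strong_orders_def V)
    then show ?thesis
      using S(3) by blast
  qed
  have fin: "finite ?N" "finite ?R"
    using finite_non_strong_orders[of G] finite_reducible_dims assms(2) by auto
  have empty: "?N = {} \<longleftrightarrow> ?R = {}"
    using NR RN by blast
  moreover have "Max ?N = Max ?R"
  \<comment> \<open>If one set is empty, so is the other, and both sides are the same unspecified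
    value \<open>Max {}\<close>.\<close>
  proof (cases "?R = {}")
    case False
    then have "?N \<noteq> {}" using empty by simp
    show ?thesis
    proof (rule antisym)
      show "Max ?N \<le> Max ?R"
        using NR \<open>?N \<noteq> {}\<close> fin(2) by (rule Max_mono)
      show "Max ?R \<le> Max ?N"
        using RN[OF Max_in[OF fin(2) False]] Max_ge[OF fin(1)] order_trans by blast
    qed
  qed (use empty in simp)
  ultimately show ?thesis ..
qed

end
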